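(* Let $n\geq 1$ and $m\geq n^2$ be integers, and let the processing times $t_{ij}$ ($i\in\{1,\dots,n\}$, $j\in\{1,\dots,m\}$) be i.i.d. random variables drawn from a continuous MHR distribution $\mathcal D$ on $[0,\infty)$. Then $$\mathbb E[\mathrm{VCG}(\mathbf t)]\leq (1+\sqrt 2)\,\mathbb E[\mathrm{OPT}(\mathbf t)].$$
   Context: There are $n$ machines and $m$ tasks; $t_{ij}\ge 0$ is the processing time of task $j$ on machine $i$, and $\mathbf t=(t_{ij})$. The VCG allocation assigns each task $j$ to a machine $i$ with $t_{ij}=\min_{i'}t_{i'j}$, ties (which have probability zero for continuous distributions) being broken uniformly at random. With $\alpha_{ij}\in\{0,1\}$ indicating whether VCG assigns task $j$ to machine $i$, $\mathrm{VCG}(\mathbf t)=\max_i\sum_{j=1}^m\alpha_{ij}t_{ij}$ is its makespan. $\mathrm{OPT}(\mathbf t)$ is the minimum, over all assignments $a:\{1,\dots,m\}\to\{1,\dots,n\}$ of tasks to machines, of the makespan $\max_i\sum_{j:a(j)=i}t_{ij}$. A continuous distribution with pdf $f$ and cdf $F$ is MHR (monotone hazard rate) if its hazard rate $h(x)=\frac{f(x)}{1-F(x)}$ is weakly increasing (on the set where $F(x)<1$). *)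

theory Defs
  imports "HOL-Probability.Probability"
begin

definition hazard_rate :: "(real \<Rightarrow> real) \<Rightarrow> real measure \<Rightarrow> real \<Rightarrow> real" where
  "hazard_rate f D x = f x / (1 - cdf D x)"

(* A density is determined only up to null sets, so a distribution is MHR if
   some version of its density has a weakly increasing hazard rate. *)
definition mhr_distribution :: "real measure \<Rightarrow> bool" where
  "mhr_distribution D \<longleftrightarrow>
     prob_space D \<and>
     (\<exists>f. f \<in> borel_measurable borel \<and> (\<forall>x. 0 \<le> f x) \<and>
          D = density lborel (\<lambda>x. ennreal (f x)) \<and>
          mono_on {x. cdf D x < 1} (hazard_rate f D))"

(* Machines are {1..n} and tasks are {1..m}; t i j is the processing time of task j
   on machine i.  An assignment is a function a from tasks to machines, so the
   indicator alpha_ij of "task j is on machine i" is a j = i. *)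
definition makespan :: "nat \<Rightarrow> nat \<Rightarrow> (nat \<Rightarrow> nat \<Rightarrow> real) \<Rightarrow> (nat \<Rightarrow> nat) \<Rightarrow> real" where
  "makespan n m t a = (MAX i\<in>{1..n}. \<Sum>j\<in>{j\<in>{1..m}. a j = i}. t i j)"

definition OPT :: "nat \<Rightarrow> nat \<Rightarrow> (nat \<Rightarrow> nat \<Rightarrow> real) \<Rightarrow> real" where
  "OPT n m t = (MIN a\<in>{1..m} \<rightarrow>\<^sub>E {1..n}. makespan n m t a)"

definition fastest_machines :: "nat \<Rightarrow> (nat \<Rightarrow> nat \<Rightarrow> real) \<Rightarrow> nat \<Rightarrow> nat set" where
  "fastest_machines n t j = {i\<in>{1..n}. t i j = (MIN i'\<in>{1..n}. t i' j)}"

(* Ties are broken uniformly, independently for different tasks. *)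
definition VCG_allocation :: "nat \<Rightarrow> nat \<Rightarrow> (nat \<Rightarrow> nat \<Rightarrow> real) \<Rightarrow> (nat \<Rightarrow> nat) pmf" where
  "VCG_allocation n m t =
     Pi_pmf {1..m} undefined (\<lambda>j. pmf_of_set (fastest_machines n t j))"

(* The makespan of the VCG allocation, averaged over the tie-breaking; it is the
   makespan of the unique VCG allocation whenever there are no ties. *)
definition VCG :: "nat \<Rightarrow> nat \<Rightarrow> (nat \<Rightarrow> nat \<Rightarrow> real) \<Rightarrow> real" where
  "VCG n m t = measure_pmf.expectation (VCG_allocation n m t) (makespan n m t)"

end

(* A monotone hazard rate makes the tail G(x) = P(X > x) submultiplicative, a property that passes to
   the minimum Y of n independent copies, since the tail of Y is G^n.  Integrating
   P(Y > x + y) <= P(Y > x) P(Y > y) over x, y >= 0 gives E[Y^2] <= 2 E[Y]^2.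

   Let mu = E[Y] and let L_i be the load of machine i under VCG.  By symmetry E[L_i] = c = m mu / n,
   and since the tasks are independent the variances of the L_i add up to at most m E[Y^2]; hence
   E[max_i L_i] <= c + sqrt (sum_i Var L_i) <= c + sqrt (2 m) mu <= (1 + sqrt 2) c when m >= n^2.
   On the other hand OPT is at least the average (1/n) sum_j Y_j of the fastest processing times, so
   E[OPT] >= c. *)
theory Submission
  imports Defs
begin

subsection \<open>Submultiplicative tails\<close>

text \<open>Submultiplicativity is carried through the proof, rather than the hazard rate, because
  it speaks of tails alone: powers preserve it, so the density of the minimum never has to be
  computed. The factor 2 in E[Y^2] <= 2 E[Y]^2 is attained by exponential times and is the source of
  sqrt 2. The loads of different machines are dependent, so their maximum is controlled by a bound
  valid for any joint law: (max_i L_i - c)^2 is one of the squares (L_i - c)^2, hence at most their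
  sum, and Jensen's inequality gives the square root. The total variance costs no extra factor n
  because almost surely a single machine carries each task, so that the squares of the shares of
  task j add up to Y_j^2. Ties, which \<open>VCG\<close> resolves at random, are null since D has a
  density, but measurability of \<open>VCG\<close> has to be shown with ties present.\<close>

lemma (in prob_space) tail_le_power:
  assumes nbu: "\<And>x y. 0 \<le> x \<Longrightarrow> 0 \<le> y \<Longrightarrow>
                  prob {\<omega>\<in>space M. x + y < X \<omega>} \<le> prob {\<omega>\<in>space M. x < X \<omega>} * prob {\<omega>\<in>space M. y < X \<omega>}"
    and "0 \<le> a"
  shows "prob {\<omega>\<in>space M. real k * a < X \<omega>} \<le> prob {\<omega>\<in>space M. a < X \<omega>} ^ k"
proof (induction k)
  case (Suc k)
  have "prob {\<omega>\<in>space M. real (Suc k) * a < X \<omega>} = prob {\<omega>\<in>space M. a + real k * a < X \<omega>}"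
    by (simp add: algebra_simps)
  also have "\<dots> \<le> prob {\<omega>\<in>space M. a < X \<omega>} * prob {\<omega>\<in>space M. real k * a < X \<omega>}"
    using \<open>0 \<le> a\<close> by (intro nbu) auto
  also have "\<dots> \<le> prob {\<omega>\<in>space M. a < X \<omega>} * prob {\<omega>\<in>space M. a < X \<omega>} ^ k"
    by (intro mult_left_mono Suc) auto
  finally show ?case by simp
qed auto

lemma (in prob_space) tail_tendsto_0:
  fixes X :: "'a \<Rightarrow> real"
  assumes [measurable]: "random_variable borel X"
  shows "(\<lambda>k. prob {\<omega>\<in>space M. real k < X \<omega>}) \<longlonglongrightarrow> 0"
proof -
  have "(\<lambda>k. prob {\<omega>\<in>space M. real k < X \<omega>}) \<longlonglongrightarrow> prob (\<Inter>k. {\<omega>\<in>space M. real k < X \<omega>})"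
    by (intro finite_Lim_measure_decseq) (auto simp: decseq_def)
  also have "(\<Inter>k. {\<omega>\<in>space M. real k < X \<omega>}) = {}"
    by (auto simp: set_eq_iff) (meson not_less real_arch_simple)
  finally show ?thesis by simp
qed

text \<open>NBU stands for ``new better than used'', the name in reliability theory for a submultiplicative tail.\<close>

lemma (in prob_space) NBU_integrable:
  fixes X :: "'a \<Rightarrow> real"
  assumes X [measurable]: "random_variable borel X" and nonneg: "AE \<omega> in M. 0 \<le> X \<omega>"
    and nbu: "\<And>x y. 0 \<le> x \<Longrightarrow> 0 \<le> y \<Longrightarrow>
                prob {\<omega>\<in>space M. x + y < X \<omega>} \<le> prob {\<omega>\<in>space M. x < X \<omega>} * prob {\<omega>\<in>space M. y < X \<omega>}"
  shows "integrable M X"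
proof -
  \<comment> \<open>Any bound below 1 would do: one point \<open>a > 0\<close> whose tail is less
    than 1 forces geometric decay along its multiples.\<close>
  have "\<forall>\<^sub>F k in sequentially. prob {\<omega>\<in>space M. real k < X \<omega>} < 1 / 2"
    using tail_tendsto_0[OF X] by (rule order_tendstoD) simp
  then have "\<forall>\<^sub>F k in sequentially. prob {\<omega>\<in>space M. real k < X \<omega>} < 1 / 2 \<and> 1 \<le> k"
    by (intro eventually_conj eventually_ge_at_top)
  then obtain n where n: "prob {\<omega>\<in>space M. real n < X \<omega>} < 1 / 2" "1 \<le> n"
    by (auto simp: eventually_sequentially)
  define a where "a = real n"
  define q where "q = prob {\<omega>\<in>space M. a < X \<omega>}"
  have a: "0 < a" and q: "0 \<le> q" "q < 1" using n by (auto simp: a_def q_def)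
  \<comment> \<open>A staircase with steps of width \<open>a\<close> dominates \<open>X\<close>; its
    expectation is a geometric series.\<close>
  have pw: "ennreal (X \<omega>) \<le> (\<Sum>k. ennreal a * indicator {\<omega>\<in>space M. real k * a < X \<omega>} \<omega>)"
    if \<omega>: "\<omega> \<in> space M" for \<omega>
  proof -
    \<comment> \<open>\<open>N\<close> is the number of steps started below
      \<open>X \<omega>\<close>. For negative \<open>X \<omega>\<close> both \<open>nat\<close> and
      \<open>ennreal\<close> truncate to 0, so the estimate holds pointwise.\<close>
    define N where "N = nat \<lceil>X \<omega> / a\<rceil>"
    have lt: "real k * a < X \<omega>" if "k < N" for k
    proof -
      have "real k < X \<omega> / a" using that unfolding N_def by linarith
      then show ?thesis using a by (simp add: field_simps)
    qed
    have "X \<omega> / a \<le> real N" unfolding N_def by linarith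
    then have "X \<omega> \<le> real N * a" using a by (simp add: field_simps)
    then have "ennreal (X \<omega>) \<le> ennreal (real N * a)" by (rule ennreal_leI)
    also have "\<dots> = (\<Sum>k<N. ennreal a * indicator {\<omega>\<in>space M. real k * a < X \<omega>} \<omega>)"
      using a \<omega> lt by (simp add: ennreal_mult ennreal_of_nat_eq_real_of_nat)
    also have "\<dots> \<le> (\<Sum>k. ennreal a * indicator {\<omega>\<in>space M. real k * a < X \<omega>} \<omega>)"
      by (rule sum_le_suminf) auto
    finally show ?thesis .
  qed
  have "(\<integral>\<^sup>+\<omega>. ennreal (X \<omega>) \<partial>M) \<le> (\<integral>\<^sup>+\<omega>. (\<Sum>k. ennreal a * indicator {\<omega>\<in>space M. real k * a < X \<omega>} \<omega>) \<partial>M)"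
    by (intro nn_integral_mono pw)
  also have "\<dots> = (\<Sum>k. ennreal a * emeasure M {\<omega>\<in>space M. real k * a < X \<omega>})"
    by (subst nn_integral_suminf) (auto simp: nn_integral_cmult)
  also have "\<dots> \<le> (\<Sum>k. ennreal (a * q ^ k))"
  proof (intro suminf_le allI)
    fix k
    have "emeasure M {\<omega>\<in>space M. real k * a < X \<omega>} \<le> ennreal (q ^ k)"
      unfolding emeasure_eq_measure q_def using a
      by (intro ennreal_leI tail_le_power nbu) auto
    then show "ennreal a * emeasure M {\<omega>\<in>space M. real k * a < X \<omega>} \<le> ennreal (a * q ^ k)"
      using a q by (simp add: ennreal_mult mult_left_mono)
  qed auto
  also have "\<dots> = ennreal (\<Sum>k. a * q ^ k)"
    using a q by (intro suminf_ennreal2) (auto intro!: summable_mult summable_geometric)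
  also have "\<dots> < \<infinity>" by simp
  finally show ?thesis
    using nonneg by (intro integrableI_nonneg) auto
qed

section \<open>Second moments from tails\<close>

text \<open>The integral is the area of the triangle that the line x + y = z cuts off from the first
  quadrant.\<close>

lemma nn_integral_indicator_double:
  fixes z :: real
  assumes "0 \<le> z"
  shows "(\<integral>\<^sup>+x. (\<integral>\<^sup>+y. indicator {0..} x * indicator {0..} y * indicator {..<z} (x + y) \<partial>lborel) \<partial>lborel)
           = ennreal (z\<^sup>2 / 2)"
proof -
  have "(\<integral>\<^sup>+y. indicator {0..} x * indicator {0..} y * indicator {..<z} (x + y) \<partial>lborel)
          = ennreal (z - x) * indicator {0..z} x" for x
  proof -
    have "(\<integral>\<^sup>+y. indicator {0..} x * indicator {0..} y * indicator {..<z} (x + y) \<partial>lborel)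
            = (\<integral>\<^sup>+y. indicator {0..z} x * indicator {0..<z - x} y \<partial>lborel)"
      by (intro nn_integral_cong) (auto split: split_indicator)
    also have "\<dots> = indicator {0..z} x * emeasure lborel {0..<z - x}"
      by (subst nn_integral_cmult) auto
    also have "\<dots> = ennreal (z - x) * indicator {0..z} x"
      by (auto split: split_indicator)
    finally show ?thesis .
  qed
  then have "(\<integral>\<^sup>+x. (\<integral>\<^sup>+y. indicator {0..} x * indicator {0..} y * indicator {..<z} (x + y) \<partial>lborel) \<partial>lborel)
      = (\<integral>\<^sup>+x. ennreal (z - x) * indicator {0..z} x \<partial>lborel)"
    by simp
  also have "\<dots> = ennreal ((z * z - z\<^sup>2 / 2) - (z * 0 - 0\<^sup>2 / 2))"
    using assms by (intro nn_integral_FTC_Icc)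
      (auto intro!: derivative_eq_intros simp: power2_eq_square)
  also have "(z * z - z\<^sup>2 / 2) - (z * 0 - 0\<^sup>2 / 2) = z\<^sup>2 / 2"
    by (simp add: power2_eq_square)
  finally show ?thesis .
qed

text \<open>Layer-cake formula: after Tonelli each outcome contributes the length of the interval
  from 0 to \<open>X \<omega>\<close>. Working in \<open>ennreal\<close> avoids presupposing
  integrability.\<close>

lemma (in prob_space) nn_integral_tail:
  fixes X :: "'a \<Rightarrow> real"
  assumes [measurable]: "random_variable borel X" and nonneg: "AE \<omega> in M. 0 \<le> X \<omega>"
  shows "(\<integral>\<^sup>+x. indicator {0..} x * ennreal (prob {\<omega>\<in>space M. x < X \<omega>}) \<partial>lborel)
           = (\<integral>\<^sup>+\<omega>. ennreal (X \<omega>) \<partial>M)"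
proof -
  interpret P: pair_sigma_finite M lborel ..
  have "(\<integral>\<^sup>+x. indicator {0..} x * ennreal (prob {\<omega>\<in>space M. x < X \<omega>}) \<partial>lborel)
      = (\<integral>\<^sup>+x. (\<integral>\<^sup>+\<omega>. indicator {0..} x * indicator {x<..} (X \<omega>) \<partial>M) \<partial>lborel)"
  proof (intro nn_integral_cong)
    fix x :: real
    have "(\<integral>\<^sup>+\<omega>. indicator {0..} x * indicator {x<..} (X \<omega>) \<partial>M)
        = (\<integral>\<^sup>+\<omega>. indicator {0..} x * indicator {\<omega>\<in>space M. x < X \<omega>} \<omega> \<partial>M)"
      by (intro nn_integral_cong) (auto split: split_indicator)
    then show "indicator {0..} x * ennreal (prob {\<omega>\<in>space M. x < X \<omega>})
        = (\<integral>\<^sup>+\<omega>. indicator {0..} x * indicator {x<..} (X \<omega>) \<partial>M)"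
      by (simp add: nn_integral_cmult emeasure_eq_measure)
  qed
  also have "\<dots> = (\<integral>\<^sup>+\<omega>. (\<integral>\<^sup>+x. indicator {0..} x * indicator {x<..} (X \<omega>) \<partial>lborel) \<partial>M)"
    by (subst P.Fubini') (auto simp: indicator_def)
  also have "\<dots> = (\<integral>\<^sup>+\<omega>. ennreal (X \<omega>) \<partial>M)"
  proof (rule nn_integral_cong_AE, use nonneg in eventually_elim)
    case (elim \<omega>)
    have "(\<integral>\<^sup>+x. indicator {0..} x * indicator {x<..} (X \<omega>) \<partial>lborel) = (\<integral>\<^sup>+x. indicator {0..<X \<omega>} x \<partial>lborel)"
      by (intro nn_integral_cong) (auto split: split_indicator)
    also have "\<dots> = ennreal (X \<omega>)" using elim by simp
    finally show ?case .
  qed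
  finally show ?thesis .
qed

text \<open>Layer cake over the plane: each outcome contributes the area of a triangle. The tail is
  taken at x + y, instead of in the usual one-dimensional formula for the second moment, so that
  submultiplicativity can split the integrand into a product.\<close>

lemma (in prob_space) nn_integral_square_tail:
  fixes X :: "'a \<Rightarrow> real"
  assumes [measurable]: "random_variable borel X" and nonneg: "AE \<omega> in M. 0 \<le> X \<omega>"
  shows "(\<integral>\<^sup>+x. (\<integral>\<^sup>+y. indicator {0..} x * indicator {0..} y * ennreal (prob {\<omega>\<in>space M. x + y < X \<omega>}) \<partial>lborel) \<partial>lborel)
           = (\<integral>\<^sup>+\<omega>. ennreal ((X \<omega>)\<^sup>2 / 2) \<partial>M)"
proof -
  interpret Q: pair_sigma_finite M "lborel \<Otimes>\<^sub>M lborel :: (real \<times> real) measure" ..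
  let ?g = "\<lambda>x y \<omega>. indicator {0..} x * indicator {0..} y * indicator {..<X \<omega>} (x + y :: real) :: ennreal"
  have "(\<integral>\<^sup>+x. (\<integral>\<^sup>+y. indicator {0..} x * indicator {0..} y * ennreal (prob {\<omega>\<in>space M. x + y < X \<omega>}) \<partial>lborel) \<partial>lborel)
      = (\<integral>\<^sup>+x. (\<integral>\<^sup>+y. (\<integral>\<^sup>+\<omega>. ?g x y \<omega> \<partial>M) \<partial>lborel) \<partial>lborel)"
  proof (intro nn_integral_cong)
    fix x y :: real
    have "(\<integral>\<^sup>+\<omega>. ?g x y \<omega> \<partial>M)
        = (\<integral>\<^sup>+\<omega>. indicator {0..} x * indicator {0..} y * indicator {\<omega>\<in>space M. x + y < X \<omega>} \<omega> \<partial>M)"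
      by (intro nn_integral_cong) (auto split: split_indicator)
    then show "indicator {0..} x * indicator {0..} y * ennreal (prob {\<omega>\<in>space M. x + y < X \<omega>}) = (\<integral>\<^sup>+\<omega>. ?g x y \<omega> \<partial>M)"
      by (simp add: nn_integral_cmult emeasure_eq_measure)
  qed
  \<comment> \<open>Merging x and y into one variable lets a single exchange with M replace
    two.\<close>
  also have "\<dots> = (\<integral>\<^sup>+z. (\<integral>\<^sup>+\<omega>. ?g (fst z) (snd z) \<omega> \<partial>M) \<partial>(lborel \<Otimes>\<^sub>M lborel))"
    by (subst lborel.nn_integral_fst[symmetric]) (auto simp: indicator_def)
  also have "\<dots> = (\<integral>\<^sup>+\<omega>. (\<integral>\<^sup>+z. ?g (fst z) (snd z) \<omega> \<partial>(lborel \<Otimes>\<^sub>M lborel)) \<partial>M)"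
    by (subst Q.Fubini') (auto simp: indicator_def)
  also have "\<dots> = (\<integral>\<^sup>+\<omega>. (\<integral>\<^sup>+x. (\<integral>\<^sup>+y. ?g x y \<omega> \<partial>lborel) \<partial>lborel) \<partial>M)"
    by (intro nn_integral_cong, subst lborel.nn_integral_fst[symmetric]) (auto simp: indicator_def)
  also have "\<dots> = (\<integral>\<^sup>+\<omega>. ennreal ((X \<omega>)\<^sup>2 / 2) \<partial>M)"
    by (rule nn_integral_cong_AE, use nonneg in eventually_elim)
       (rule nn_integral_indicator_double)
  finally show ?thesis .
qed

text \<open>After the tail at x + y is bounded by a product, the double integral factors into two
  copies of the mean. The factor 2 is the inverse of the 1/2 in the area of the triangle.\<close>

lemma (in prob_space) NBU_second_moment:
  fixes X :: "'a \<Rightarrow> real"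
  assumes X [measurable]: "random_variable borel X" and nonneg: "AE \<omega> in M. 0 \<le> X \<omega>"
    and nbu: "\<And>x y. 0 \<le> x \<Longrightarrow> 0 \<le> y \<Longrightarrow>
                prob {\<omega>\<in>space M. x + y < X \<omega>} \<le> prob {\<omega>\<in>space M. x < X \<omega>} * prob {\<omega>\<in>space M. y < X \<omega>}"
  shows "integrable M (\<lambda>\<omega>. (X \<omega>)\<^sup>2)" and "expectation (\<lambda>\<omega>. (X \<omega>)\<^sup>2) \<le> 2 * (expectation X)\<^sup>2"
proof -
  have int: "integrable M X" by (rule NBU_integrable) fact+
  have E: "0 \<le> expectation X" using nonneg by (rule integral_nonneg_AE)
  let ?G = "\<lambda>x. prob {\<omega>\<in>space M. x < X \<omega>}"
  \<comment> \<open>The tail is decreasing, so its negative is monotone and therefore Borel.\<close>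
  have [measurable]: "?G \<in> borel_measurable borel"
  proof -
    have "mono (\<lambda>x. - ?G x)"
      by (auto simp: mono_def intro!: finite_measure_mono)
    then have "(\<lambda>x. - (- ?G x)) \<in> borel_measurable borel"
      by (intro borel_measurable_uminus borel_measurable_mono)
    then show ?thesis by simp
  qed
  have "(\<integral>\<^sup>+\<omega>. ennreal ((X \<omega>)\<^sup>2 / 2) \<partial>M)
      \<le> (\<integral>\<^sup>+x. (\<integral>\<^sup>+y. (indicator {0..} x * ennreal (?G x)) * (indicator {0..} y * ennreal (?G y)) \<partial>lborel) \<partial>lborel)"
    unfolding nn_integral_square_tail[OF X nonneg, symmetric]
  proof (intro nn_integral_mono)
    fix x y :: real
    show "indicator {0..} x * indicator {0..} y * ennreal (?G (x + y))
        \<le> (indicator {0..} x * ennreal (?G x)) * (indicator {0..} y * ennreal (?G y))"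
      using nbu[of x y] by (auto split: split_indicator simp flip: ennreal_mult intro!: ennreal_leI)
  qed
  also have "\<dots> = (\<integral>\<^sup>+\<omega>. ennreal (X \<omega>) \<partial>M) * (\<integral>\<^sup>+\<omega>. ennreal (X \<omega>) \<partial>M)"
    unfolding nn_integral_tail[OF X nonneg, symmetric]
    by (subst nn_integral_cmult, simp, subst nn_integral_multc) auto
  also have "(\<integral>\<^sup>+\<omega>. ennreal (X \<omega>) \<partial>M) = ennreal (expectation X)"
    using int nonneg by (rule nn_integral_eq_integral)
  also have "ennreal (expectation X) * ennreal (expectation X) = ennreal ((expectation X)\<^sup>2)"
    using E by (simp add: ennreal_mult power2_eq_square)
  finally have le: "(\<integral>\<^sup>+\<omega>. ennreal ((X \<omega>)\<^sup>2 / 2) \<partial>M) \<le> ennreal ((expectation X)\<^sup>2)" .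
  also have "\<dots> < \<infinity>" by simp
  finally have int2: "integrable M (\<lambda>\<omega>. (X \<omega>)\<^sup>2 / 2)"
    by (intro integrableI_nonneg) auto
  have "ennreal (expectation (\<lambda>\<omega>. (X \<omega>)\<^sup>2 / 2)) \<le> ennreal ((expectation X)\<^sup>2)"
    using le nn_integral_eq_integral[OF int2] by simp
  then have "expectation (\<lambda>\<omega>. (X \<omega>)\<^sup>2 / 2) \<le> (expectation X)\<^sup>2"
    by (simp add: ennreal_le_iff)
  then show "expectation (\<lambda>\<omega>. (X \<omega>)\<^sup>2) \<le> 2 * (expectation X)\<^sup>2" by simp
  show "integrable M (\<lambda>\<omega>. (X \<omega>)\<^sup>2)"
    using integrable_mult_right[OF int2, of 2] by simp
qed

section \<open>From a monotone hazard rate to a submultiplicative tail\<close>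

text \<open>The familiar argument differentiates log (1 - F), but the density is merely measurable
  and F need not have derivative f everywhere. Instead an inequality between densities is integrated
  over an interval, which uses only continuity of F.\<close>

lemma mhr_tail_submult:
  assumes mhr: "mhr_distribution D" and nonneg: "AE x in D. 0 \<le> x"
    and x: "0 \<le> x" and s: "0 \<le> s"
  shows "1 - cdf D (x + s) \<le> (1 - cdf D x) * (1 - cdf D s)"
proof (rule ccontr)
  assume neg: "\<not> ?thesis"
  obtain f where f [measurable]: "f \<in> borel_measurable borel" and f0: "\<And>x. 0 \<le> f x"
    and D: "D = density lborel (\<lambda>x. ennreal (f x))"
    and mono: "mono_on {x. cdf D x < 1} (hazard_rate f D)"
    and "prob_space D"
    using mhr by (auto simp: mhr_distribution_def)
  interpret prob_space D by fact
  interpret real_distribution D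
    by standard (auto simp: D)
  have cont: "isCont (cdf D) y" for y
    unfolding isCont_cdf unfolding measure_def D
    by (subst emeasure_density) (auto intro!: nn_integral_null_set simp: null_sets_def)
  \<comment> \<open>With x fixed, \<open>P\<close> and \<open>Q\<close> are the two sides of the
    claim as functions of the second argument; the negated claim says
    \<open>Q s < P s\<close>.\<close>
  define P where "P u = 1 - cdf D (x + u)" for u
  define Q where "Q u = (1 - cdf D x) * (1 - cdf D u)" for u
  have cont_PQ: "continuous_on A (\<lambda>u. P u - Q u)" for A
    unfolding P_def Q_def
    by (intro continuous_at_imp_continuous_on ballI continuous_intros isCont_o2[OF _ cont])
  \<comment> \<open>Support in the nonnegative reals and the absence of atoms give F(0) = 0, so
    \<open>P\<close> and \<open>Q\<close> start from the same value at 0.\<close>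
  have "measure D {..0} = measure D {0}"
    using nonneg by (intro finite_measure_eq_AE) auto
  also have "\<dots> = 0" using cont isCont_cdf by blast
  finally have cdf0: "cdf D 0 = 0" by (simp add: cdf_def)
  have PQs: "P s > Q s" using neg by (simp add: P_def Q_def)
  text \<open>On the last interval \<open>(r, s]\<close> where \<open>Q < P\<close>, the hazard rate at \<open>x + u\<close> is at least the one at \<open>u\<close>, so
    \<open>P\<close> decreases at least as fast as \<open>Q\<close>, which contradicts \<open>P r \<le> Q r\<close>.\<close>
  define S where "S = {0..s} \<inter> (\<lambda>u. P u - Q u) -` {..0}"
  have "closed S" unfolding S_def
    by (intro continuous_closed_preimage cont_PQ) auto
  moreover have "0 \<in> S" using s by (simp add: S_def P_def Q_def cdf0)
  moreover have "bdd_above S" by (auto simp: S_def)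
  ultimately have "Sup S \<in> S" by (intro closed_contains_Sup) auto
  define r where "r = Sup S"
  have r: "0 \<le> r" "r \<le> s" "P r \<le> Q r" using \<open>Sup S \<in> S\<close> by (auto simp: r_def S_def)
  have "r < s" using r PQs by (cases "r = s") auto
  have PQ: "Q u < P u" if "u \<in> {r<..s}" for u
  proof (rule ccontr)
    assume "\<not> Q u < P u"
    then have "u \<in> S" using that r by (auto simp: S_def)
    then have "u \<le> r" unfolding r_def using \<open>bdd_above S\<close> by (rule cSup_upper)
    then show False using that by simp
  qed
  have "0 \<le> 1 - cdf D v" for v using cdf_bounded_prob[of v] by simp
  then have "0 \<le> Q s" by (simp add: Q_def)
  \<comment> \<open>This places x + u, for every u up to s, in the set where the hazard rate is
    monotone.\<close>
  with PQs have "cdf D (x + s) < 1" by (simp add: P_def)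
  \<comment> \<open>The two sides are formally the negated derivatives of \<open>Q\<close> and
    \<open>P\<close>. Rewriting a density as hazard rate times tail brings in both
    \<open>Q u < P u\<close> and the monotonicity of the hazard rate.\<close>
  have ptw: "(1 - cdf D x) * f u \<le> f (x + u)" if u: "u \<in> {r<..s}" for u
  proof -
    have lt: "cdf D (x + u) < 1"
      using cdf_nondecreasing[of "x + u" "x + s"] u \<open>cdf D (x + s) < 1\<close> by simp
    moreover have "cdf D u \<le> cdf D (x + u)" using x by (intro cdf_nondecreasing) simp
    ultimately have lt': "cdf D u < 1" by simp
    have "hazard_rate f D u \<le> hazard_rate f D (x + u)"
      using lt lt' x by (intro mono_onD[OF mono]) auto
    have "(1 - cdf D x) * f u = hazard_rate f D u * Q u"
      using lt' by (simp add: hazard_rate_def Q_def)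
    also have "\<dots> \<le> hazard_rate f D u * P u"
      using PQ[OF u] f0[of u] lt' by (intro mult_left_mono) (auto simp: hazard_rate_def)
    also have "\<dots> \<le> hazard_rate f D (x + u) * P u"
      using lt \<open>hazard_rate f D u \<le> hazard_rate f D (x + u)\<close> by (intro mult_right_mono) (auto simp: P_def)
    also have "\<dots> = f (x + u)" using lt by (simp add: hazard_rate_def P_def)
    finally show ?thesis .
  qed
  have emeasure_D: "emeasure D A = (\<integral>\<^sup>+u. ennreal (f u) * indicator A u \<partial>lborel)"
    if "A \<in> sets borel" for A
    using that unfolding D by (subst emeasure_density) auto
  have cx: "0 \<le> 1 - cdf D x" using cdf_bounded_prob[of x] by simp
  have "ennreal ((1 - cdf D x) * measure D {r<..s}) = ennreal (1 - cdf D x) * emeasure D {r<..s}"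
    using cx by (simp add: ennreal_mult emeasure_eq_measure)
  also have "\<dots> = (\<integral>\<^sup>+u. ennreal ((1 - cdf D x) * f u) * indicator {r<..s} u \<partial>lborel)"
    using cx f0 by (simp add: emeasure_D nn_integral_cmult ennreal_mult mult.assoc)
  also have "\<dots> \<le> (\<integral>\<^sup>+u. ennreal (f (x + u)) * indicator {x + r<..x + s} (x + u) \<partial>lborel)"
    by (intro nn_integral_mono) (auto split: split_indicator intro!: ennreal_leI ptw)
  also have "\<dots> = emeasure D {x + r<..x + s}"
    unfolding emeasure_D[OF greaterThanAtMost_borel]
    by (subst nn_integral_real_affine[where c = 1 and t = x]) auto
  also have "\<dots> = ennreal (measure D {x + r<..x + s})" by (rule emeasure_eq_measure)
  finally have "(1 - cdf D x) * measure D {r<..s} \<le> measure D {x + r<..x + s}"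
    by (simp add: ennreal_le_iff)
  then have "(1 - cdf D x) * (cdf D s - cdf D r) \<le> cdf D (x + s) - cdf D (x + r)"
    using \<open>r < s\<close> by (simp add: cdf_diff_eq)
  then have "P s - Q s \<le> P r - Q r" by (simp add: P_def Q_def algebra_simps)
  then show False using r PQs by simp
qed

subsection \<open>Variance and the expected maximum\<close>

text \<open>Bienayme's identity: expand the square of the centred sum; independence makes the mixed
  products vanish in expectation. Integrability is stated for the deviation itself because
  \<open>expectation_Max_le\<close> asks for it in that form.\<close>

lemma (in prob_space) variance_sum_indep:
  fixes X :: "'i \<Rightarrow> 'a \<Rightarrow> real"
  assumes indep: "indep_vars (\<lambda>_. borel) X I" and fin: "finite I"
    and int: "\<And>i. i \<in> I \<Longrightarrow> integrable M (X i)"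
    and int2: "\<And>i. i \<in> I \<Longrightarrow> integrable M (\<lambda>\<omega>. (X i \<omega>)\<^sup>2)"
  shows "integrable M (\<lambda>\<omega>. ((\<Sum>i\<in>I. X i \<omega>) - (\<Sum>i\<in>I. expectation (X i)))\<^sup>2)"
    and "variance (\<lambda>\<omega>. \<Sum>i\<in>I. X i \<omega>) = (\<Sum>i\<in>I. variance (X i))"
proof -
  define U where "U i \<omega> = X i \<omega> - expectation (X i)" for i \<omega>
  have U: "indep_vars (\<lambda>_. borel) U I"
    unfolding U_def by (rule indep_vars_compose2[OF indep]) simp
  have intU: "integrable M (U i)" and EU: "expectation (U i) = 0" if "i \<in> I" for i
    using int[OF that] by (auto simp: U_def[abs_def] prob_space)
  have UU: "integrable M (\<lambda>\<omega>. U i \<omega> * U k \<omega>)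
      \<and> expectation (\<lambda>\<omega>. U i \<omega> * U k \<omega>) = (if k = i then variance (X i) else 0)"
    if "i \<in> I" "k \<in> I" for i k
  proof (cases "k = i")
    case True
    have "U i \<omega> * U i \<omega> = (X i \<omega>)\<^sup>2 - 2 * expectation (X i) * X i \<omega> + (expectation (X i))\<^sup>2" for \<omega>
      by (simp add: U_def power2_eq_square algebra_simps)
    then have "integrable M (\<lambda>\<omega>. U i \<omega> * U i \<omega>)"
      using int int2 that by simp
    then show ?thesis using True by (simp add: U_def power2_eq_square)
  next
    case False
    have ik: "indep_vars (\<lambda>_. borel) U {i, k}"
      using U by (rule indep_vars_subset) (use that in auto)
    have "integrable M (\<lambda>\<omega>. \<Prod>j\<in>{i, k}. U j \<omega>)"
      using that intU by (intro indep_vars_integrable[OF _ ik]) auto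
    moreover have "expectation (\<lambda>\<omega>. \<Prod>j\<in>{i, k}. U j \<omega>) = (\<Prod>j\<in>{i, k}. expectation (U j))"
      using that intU by (intro indep_vars_lebesgue_integral[OF _ ik]) auto
    ultimately show ?thesis using False that EU by simp
  qed
  have eq: "((\<Sum>i\<in>I. X i \<omega>) - (\<Sum>i\<in>I. expectation (X i)))\<^sup>2 = (\<Sum>i\<in>I. \<Sum>k\<in>I. U i \<omega> * U k \<omega>)" for \<omega>
    by (simp add: U_def power2_eq_square sum_subtractf[symmetric] sum_product)
  show "integrable M (\<lambda>\<omega>. ((\<Sum>i\<in>I. X i \<omega>) - (\<Sum>i\<in>I. expectation (X i)))\<^sup>2)"
    unfolding eq using UU by auto
  have "variance (\<lambda>\<omega>. \<Sum>i\<in>I. X i \<omega>) = expectation (\<lambda>\<omega>. \<Sum>i\<in>I. \<Sum>k\<in>I. U i \<omega> * U k \<omega>)"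
    using int eq by (simp add: Bochner_Integration.integral_sum)
  also have "\<dots> = (\<Sum>i\<in>I. \<Sum>k\<in>I. if k = i then variance (X i) else 0)"
    using UU by (simp add: Bochner_Integration.integral_sum)
  also have "\<dots> = (\<Sum>i\<in>I. variance (X i))" using fin by simp
  finally show "variance (\<lambda>\<omega>. \<Sum>i\<in>I. X i \<omega>) = (\<Sum>i\<in>I. variance (X i))" .
qed

text \<open>The maximum is attained by some \<open>L i\<close>, so its squared deviation from c is
  one term of a sum of squares; the variance of \<open>W\<close> being nonnegative then plays the
  role of Jensen's inequality.\<close>

lemma (in prob_space) expectation_Max_le:
  fixes L :: "'i \<Rightarrow> 'a \<Rightarrow> real"
  assumes I: "finite I" "I \<noteq> {}"
    and int: "\<And>i. i \<in> I \<Longrightarrow> integrable M (L i)"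
    and int2: "\<And>i. i \<in> I \<Longrightarrow> integrable M (\<lambda>\<omega>. (L i \<omega> - c)\<^sup>2)"
  shows "expectation (\<lambda>\<omega>. MAX i\<in>I. L i \<omega>) \<le> c + sqrt (\<Sum>i\<in>I. expectation (\<lambda>\<omega>. (L i \<omega> - c)\<^sup>2))"
proof -
  define W where "W \<omega> = (MAX i\<in>I. L i \<omega>) - c" for \<omega>
  have intMax: "integrable M (\<lambda>\<omega>. MAX i\<in>I. L i \<omega>)"
    by (intro integrable_MAX I int)
  have W: "integrable M W" unfolding W_def using intMax by simp
  have le: "(W \<omega>)\<^sup>2 \<le> (\<Sum>i\<in>I. (L i \<omega> - c)\<^sup>2)" for \<omega>
  proof -
    have "(MAX i\<in>I. L i \<omega>) \<in> (\<lambda>i. L i \<omega>) ` I" using I by (intro Max_in) auto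
    then obtain i where "i \<in> I" "(MAX i\<in>I. L i \<omega>) = L i \<omega>" by auto
    then show ?thesis unfolding W_def using I
      by (auto intro!: member_le_sum[of i I "\<lambda>i. (L i \<omega> - c)\<^sup>2"])
  qed
  have intS: "integrable M (\<lambda>\<omega>. \<Sum>i\<in>I. (L i \<omega> - c)\<^sup>2)" using int2 by simp
  have W2: "integrable M (\<lambda>\<omega>. (W \<omega>)\<^sup>2)"
    by (rule Bochner_Integration.integrable_bound[OF intS])
       (use W le in \<open>auto simp: abs_of_nonneg[OF sum_nonneg]\<close>)
  have "(expectation W)\<^sup>2 \<le> expectation (\<lambda>\<omega>. (W \<omega>)\<^sup>2)"
    using variance_positive[of W] variance_eq[OF W W2] by simp
  also have "\<dots> \<le> expectation (\<lambda>\<omega>. \<Sum>i\<in>I. (L i \<omega> - c)\<^sup>2)"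
    by (intro integral_mono W2 intS le)
  also have "\<dots> = (\<Sum>i\<in>I. expectation (\<lambda>\<omega>. (L i \<omega> - c)\<^sup>2))"
    using int2 by (simp add: Bochner_Integration.integral_sum)
  finally have "expectation W \<le> sqrt (\<Sum>i\<in>I. expectation (\<lambda>\<omega>. (L i \<omega> - c)\<^sup>2))"
    by (rule real_le_rsqrt)
  moreover have "expectation W = expectation (\<lambda>\<omega>. MAX i\<in>I. L i \<omega>) - c"
    unfolding W_def using intMax by (simp add: prob_space)
  ultimately show ?thesis by simp
qed

subsection \<open>Makespans\<close>

lemma finite_fastest_machines [simp]: "finite (fastest_machines n t j)"
  by (simp add: fastest_machines_def)

lemma fastest_machines_nonempty:
  assumes "1 \<le> n"
  shows "fastest_machines n t j \<noteq> {}"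
proof -
  have "(MIN i\<in>{1..n}. t i j) \<in> (\<lambda>i. t i j) ` {1..n}" using assms by (intro Min_in) auto
  then show ?thesis by (auto simp: fastest_machines_def)
qed

text \<open>Without ties exactly one summand survives. Taking \<open>f\<close> to be the identity
  gives the means below, and squaring gives the second moments.\<close>

lemma sum_fastest:
  fixes f :: "real \<Rightarrow> real" and n :: nat and t :: "nat \<Rightarrow> nat \<Rightarrow> real"
  assumes "1 \<le> n" and "inj_on (\<lambda>i. t i j) {1..n}"
  shows "(\<Sum>i\<in>{1..n}. if t i j = (MIN i\<in>{1..n}. t i j) then f (t i j) else 0) = f (MIN i\<in>{1..n}. t i j)"
proof -
  obtain k where k: "k \<in> fastest_machines n t j" using fastest_machines_nonempty[OF assms(1)] by blast
  then have "t i j = (MIN i\<in>{1..n}. t i j) \<longleftrightarrow> i = k" if "i \<in> {1..n}" for i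
    using that inj_onD[OF assms(2), of i k] by (auto simp: fastest_machines_def)
  then have "(\<Sum>i\<in>{1..n}. if t i j = (MIN i\<in>{1..n}. t i j) then f (t i j) else 0)
      = (\<Sum>i\<in>{1..n}. if i = k then f (MIN i\<in>{1..n}. t i j) else 0)"
    by (intro sum.cong refl) metis
  also have "\<dots> = f (MIN i\<in>{1..n}. t i j)"
    using k by (subst sum.delta) (simp_all add: fastest_machines_def)
  finally show ?thesis .
qed

text \<open>Each set of fastest machines is a singleton, so the tie-breaking law is a point mass and
  the expectation reduces to one makespan.\<close>

lemma VCG_no_ties:
  assumes n: "1 \<le> n" and inj: "\<And>j. j \<in> {1..m} \<Longrightarrow> inj_on (\<lambda>i. t i j) {1..n}"
  shows "VCG n m t = (MAX i\<in>{1..n}. \<Sum>j\<in>{1..m}. if t i j = (MIN i\<in>{1..n}. t i j) then t i j else 0)"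
proof -
  define k where "k j = (SOME i. i \<in> fastest_machines n t j)" for j
  have k: "k j \<in> fastest_machines n t j" for j
    unfolding k_def using fastest_machines_nonempty[OF n] by (simp add: some_in_eq)
  have eq: "t i j = (MIN i\<in>{1..n}. t i j) \<longleftrightarrow> k j = i" if "i \<in> {1..n}" "j \<in> {1..m}" for i j
    using that k[of j] inj_onD[OF inj, of j i "k j"] by (auto simp: fastest_machines_def)
  have "fastest_machines n t j = {k j}" if "j \<in> {1..m}" for j
    using eq[OF _ that] k[of j] by (auto simp: fastest_machines_def)
  then have "VCG_allocation n m t = Pi_pmf {1..m} undefined (\<lambda>j. return_pmf (k j))"
    unfolding VCG_allocation_def by (intro Pi_pmf_cong) (auto simp: pmf_of_set_singleton)
  then have "VCG n m t = makespan n m t (\<lambda>j. if j \<in> {1..m} then k j else undefined)"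
    by (simp add: VCG_def)
  also have "\<dots> = (MAX i\<in>{1..n}. \<Sum>j\<in>{1..m}. if k j = i then t i j else 0)"
    unfolding makespan_def
    by (intro arg_cong[where f = Max] image_cong refl)
       (simp add: sum.inter_filter[symmetric] conj_commute cong: conj_cong)
  also have "\<dots> = (MAX i\<in>{1..n}. \<Sum>j\<in>{1..m}. if t i j = (MIN i\<in>{1..n}. t i j) then t i j else 0)"
    using eq by (intro arg_cong[where f = Max] image_cong sum.cong refl) auto
  finally show ?thesis .
qed

text \<open>Holds with ties as well. It turns the expectation over a law that depends on the times
  into a finite arithmetic expression in them, from which measurability can be read off; each
  denominator counts the fastest machines of a task.\<close>

lemma VCG_eq_sum:
  assumes n: "1 \<le> n"
  shows "VCG n m t = (\<Sum>a\<in>PiE_dflt {1..m} undefined (\<lambda>_. {1..n}). makespan n m t a *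
           (\<Prod>j\<in>{1..m}. (if t (a j) j = (MIN i\<in>{1..n}. t i j) then 1 else 0) /
              (\<Sum>i\<in>{1..n}. if t i j = (MIN i\<in>{1..n}. t i j) then 1 else 0)))"
proof -
  have card: "real (card (fastest_machines n t j)) = (\<Sum>i\<in>{1..n}. if t i j = (MIN i\<in>{1..n}. t i j) then 1 else 0)" for j
    unfolding fastest_machines_def by (simp flip: sum.inter_filter)
  have "VCG n m t = (\<Sum>a\<in>PiE_dflt {1..m} undefined (\<lambda>_. {1..n}). makespan n m t a * pmf (VCG_allocation n m t) a)"
    unfolding VCG_def
  proof (rule integral_measure_pmf_real)
    show "finite (PiE_dflt {1..m} undefined (\<lambda>_. {1..n}))" by auto
    fix a assume "a \<in> set_pmf (VCG_allocation n m t)"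
    then show "a \<in> PiE_dflt {1..m} undefined (\<lambda>_. {1..n})"
      using fastest_machines_nonempty[OF n, of t]
      by (auto simp: VCG_allocation_def set_Pi_pmf PiE_dflt_def fastest_machines_def)
  qed
  also have "\<dots> = (\<Sum>a\<in>PiE_dflt {1..m} undefined (\<lambda>_. {1..n}). makespan n m t a *
           (\<Prod>j\<in>{1..m}. (if t (a j) j = (MIN i\<in>{1..n}. t i j) then 1 else 0) /
              (\<Sum>i\<in>{1..n}. if t i j = (MIN i\<in>{1..n}. t i j) then 1 else 0)))"
  proof (intro sum.cong refl arg_cong2[where f = "(*)"])
    fix a assume a: "a \<in> PiE_dflt {1..m} undefined (\<lambda>_. {1..n})"
    have "pmf (VCG_allocation n m t) a = (\<Prod>j\<in>{1..m}. indicator (fastest_machines n t j) (a j) / card (fastest_machines n t j))"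
      unfolding VCG_allocation_def using a fastest_machines_nonempty[OF n, of t]
      by (subst pmf_Pi') (auto simp: PiE_dflt_def)
    also have "\<dots> = (\<Prod>j\<in>{1..m}. (if t (a j) j = (MIN i\<in>{1..n}. t i j) then 1 else 0) /
              (\<Sum>i\<in>{1..n}. if t i j = (MIN i\<in>{1..n}. t i j) then 1 else 0))"
      unfolding card using a
      by (intro prod.cong refl) (auto simp: fastest_machines_def PiE_dflt_def indicator_def)
    finally show "pmf (VCG_allocation n m t) a = \<dots>" .
  qed
  finally show ?thesis .
qed

text \<open>Under any assignment the n loads add up to at least the left-hand side, and the largest
  load is at least their average.\<close>

lemma sum_Min_le_OPT:
  assumes n: "1 \<le> n"
  shows "(\<Sum>j\<in>{1..m}. MIN i\<in>{1..n}. t i j) \<le> real n * OPT n m t"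
proof -
  have le: "(\<Sum>j\<in>{1..m}. MIN i\<in>{1..n}. t i j) \<le> real n * makespan n m t a"
    if a: "a \<in> {1..m} \<rightarrow>\<^sub>E {1..n}" for a
  proof -
    have "(\<Sum>j\<in>{1..m}. MIN i\<in>{1..n}. t i j) \<le> (\<Sum>j\<in>{1..m}. t (a j) j)"
      using a by (intro sum_mono Min_le) auto
    also have "\<dots> = (\<Sum>i\<in>{1..n}. \<Sum>j\<in>{j\<in>{1..m}. a j = i}. t (a j) j)"
      using a by (intro sum.group[symmetric]) auto
    also have "\<dots> = (\<Sum>i\<in>{1..n}. \<Sum>j\<in>{j\<in>{1..m}. a j = i}. t i j)"
      by (intro sum.cong refl) auto
    also have "\<dots> \<le> (\<Sum>i\<in>{1..n}. makespan n m t a)"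
      unfolding makespan_def by (intro sum_mono Max_ge) auto
    finally show ?thesis by simp
  qed
  have "OPT n m t \<in> makespan n m t ` ({1..m} \<rightarrow>\<^sub>E {1..n})"
    unfolding OPT_def using n by (intro Min_in) (auto simp: finite_PiE PiE_eq_empty_iff)
  then show ?thesis using le by auto
qed

subsection \<open>Independent and identically distributed processing times\<close>

locale iid_mhr_times = prob_space M
  for M :: "'a measure" +
  fixes n m :: nat and D :: "real measure" and t :: "nat \<Rightarrow> nat \<Rightarrow> 'a \<Rightarrow> real"
  assumes n: "1 \<le> n"
    and mhr: "mhr_distribution D" and D_nonneg: "AE x in D. 0 \<le> x"
    and indep: "indep_vars (\<lambda>_. borel) (\<lambda>(i, j). t i j) ({1..n} \<times> {1..m})"
    and distr_t: "\<And>i j. i \<in> {1..n} \<Longrightarrow> j \<in> {1..m} \<Longrightarrow> distr M borel (t i j) = D"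
begin

section \<open>Laws and moments of the processing times and of the fastest times\<close>

sublocale D: real_distribution D
proof -
  obtain f where "prob_space D" and D: "D = density lborel (\<lambda>x. ennreal (f x))"
    using mhr by (auto simp: mhr_distribution_def)
  then interpret D: prob_space D by simp
  show "real_distribution D"
  proof
    show "sets D = sets borel" unfolding D by simp
  qed
qed

lemma D_singleton: "emeasure D {x} = 0"
proof -
  obtain f where "f \<in> borel_measurable borel" "D = density lborel (\<lambda>x. ennreal (f x))"
    using mhr by (auto simp: mhr_distribution_def)
  then show ?thesis
    by (auto simp: emeasure_density intro!: nn_integral_null_set simp: null_sets_def)
qed

lemma t_measurable [measurable]:
  assumes "i \<in> {1..n}" "j \<in> {1..m}"
  shows "t i j \<in> borel_measurable M"
proof -
  have "random_variable borel (case (i, j) of (i, j) \<Rightarrow> t i j)"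
    using indep assms unfolding indep_vars_def by blast
  then show ?thesis by simp
qed

definition fastest_time :: "nat \<Rightarrow> 'a \<Rightarrow> real" where
  "fastest_time j \<omega> = (MIN i\<in>{1..n}. t i j \<omega>)"

text \<open>With a tie the task is charged to every fastest machine, so this is the share under VCG
  only almost surely; in return it is a deterministic function of the times of task j.\<close>

definition VCG_time :: "nat \<Rightarrow> nat \<Rightarrow> 'a \<Rightarrow> real" where
  "VCG_time i j \<omega> = (if t i j \<omega> = fastest_time j \<omega> then t i j \<omega> else 0)"

lemma fastest_time_measurable [measurable]:
  assumes "j \<in> {1..m}"
  shows "fastest_time j \<in> borel_measurable M"
  unfolding fastest_time_def using assms by (intro borel_measurable_Min) auto

lemma VCG_time_measurable [measurable]:
  assumes "i \<in> {1..n}" "j \<in> {1..m}"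
  shows "VCG_time i j \<in> borel_measurable M"
  unfolding VCG_time_def[abs_def] using assms by measurable

lemma AE_t_nonneg:
  assumes "i \<in> {1..n}" "j \<in> {1..m}"
  shows "AE \<omega> in M. 0 \<le> t i j \<omega>"
proof -
  have "AE x in distr M borel (t i j). 0 \<le> x"
    unfolding distr_t[OF assms] by (rule D_nonneg)
  then show ?thesis using assms by (subst (asm) AE_distr_iff) auto
qed

lemma AE_fastest_time_nonneg:
  assumes j: "j \<in> {1..m}"
  shows "AE \<omega> in M. 0 \<le> fastest_time j \<omega>"
proof -
  have "AE \<omega> in M. \<forall>i\<in>{1..n}. 0 \<le> t i j \<omega>"
    using AE_t_nonneg[OF _ j] by (intro AE_finite_allI) auto
  then show ?thesis
    by eventually_elim (use n in \<open>auto simp: fastest_time_def\<close>)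
qed

lemma prob_t_gt:
  assumes "i \<in> {1..n}" "j \<in> {1..m}"
  shows "prob {\<omega>\<in>space M. x < t i j \<omega>} = 1 - cdf D x"
proof -
  have "prob {\<omega>\<in>space M. x < t i j \<omega>} = measure (distr M borel (t i j)) {x<..}"
    using assms by (subst measure_distr) (auto intro!: arg_cong[where f = prob])
  also have "\<dots> = measure D (space D - {..x})"
    unfolding distr_t[OF assms] by (intro arg_cong[where f = "measure D"]) auto
  also have "\<dots> = 1 - cdf D x"
    unfolding cdf_def by (subst D.prob_compl) auto
  finally show ?thesis .
qed

text \<open>Reindexing from pairs to machines: the singletons {(i, j)} with j fixed are disjoint
  blocks, and evaluating each block at its only index recovers \<open>t i j\<close>.\<close>

lemma indep_column:
  assumes "j \<in> {1..m}"
  shows "indep_vars (\<lambda>_. borel) (\<lambda>i. t i j) {1..n}"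
proof -
  have "indep_vars (\<lambda>i. PiM {(i, j)} (\<lambda>_. borel))
          (\<lambda>i \<omega>. restrict (\<lambda>p. (case p of (i, j) \<Rightarrow> t i j) \<omega>) {(i, j)}) {1..n}"
    by (rule indep_vars_restrict[OF indep]) (use assms in \<open>auto simp: disjoint_family_on_def\<close>)
  then have "indep_vars (\<lambda>_. borel)
      (\<lambda>i \<omega>. (\<lambda>v. v (i, j)) (restrict (\<lambda>p. (case p of (i, j) \<Rightarrow> t i j) \<omega>) {(i, j)})) {1..n}"
    by (rule indep_vars_compose2) auto
  then show ?thesis by simp
qed

text \<open>This joint law is the same for every task and symmetric in the machines, which is what
  \<open>expectation_VCG_time_eq\<close> exploits.\<close>

lemma distr_column:
  assumes "j \<in> {1..m}"
  shows "distr M (PiM {1..n} (\<lambda>_. borel)) (\<lambda>\<omega>. \<lambda>i\<in>{1..n}. t i j \<omega>) = PiM {1..n} (\<lambda>_. D)"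
proof -
  have "distr M (PiM {1..n} (\<lambda>_. borel)) (\<lambda>\<omega>. \<lambda>i\<in>{1..n}. t i j \<omega>)
      = PiM {1..n} (\<lambda>i. distr M borel (t i j))"
    using n assms indep_column[OF assms]
    by (subst (asm) indep_vars_iff_distr_eq_PiM') auto
  also have "\<dots> = PiM {1..n} (\<lambda>_. D)"
    using assms by (intro PiM_cong) (auto simp: distr_t)
  finally show ?thesis .
qed

lemma prob_fastest_time_gt:
  assumes j: "j \<in> {1..m}"
  shows "prob {\<omega>\<in>space M. x < fastest_time j \<omega>} = (1 - cdf D x) ^ n"
proof -
  have "prob {\<omega>\<in>space M. x < fastest_time j \<omega>} = prob (\<Inter>i\<in>{1..n}. t i j -` {x<..} \<inter> space M)"
    using n by (intro arg_cong[where f = prob]) (auto simp: fastest_time_def)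
  also have "\<dots> = (\<Prod>i\<in>{1..n}. prob (t i j -` {x<..} \<inter> space M))"
    using n by (intro indep_varsD_finite[OF indep_column[OF j]]) auto
  also have "\<dots> = (\<Prod>i\<in>{1..n}. 1 - cdf D x)"
  proof (intro prod.cong refl)
    fix i assume i: "i \<in> {1..n}"
    have "t i j -` {x<..} \<inter> space M = {\<omega>\<in>space M. x < t i j \<omega>}" by auto
    then show "prob (t i j -` {x<..} \<inter> space M) = 1 - cdf D x"
      using prob_t_gt[OF i j] by simp
  qed
  finally show ?thesis by simp
qed

text \<open>Integrability of every single time, beyond that of the minima, makes the makespans of
  arbitrary assignments integrable, and with them \<open>OPT\<close>.\<close>

lemma integrable_t:
  assumes ij: "i \<in> {1..n}" "j \<in> {1..m}"
  shows "integrable M (t i j)"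
proof (rule NBU_integrable)
  show "t i j \<in> borel_measurable M" using ij by (rule t_measurable)
  show "AE \<omega> in M. 0 \<le> t i j \<omega>" using ij by (rule AE_t_nonneg)
  show "prob {\<omega>\<in>space M. x + y < t i j \<omega>} \<le> prob {\<omega>\<in>space M. x < t i j \<omega>} * prob {\<omega>\<in>space M. y < t i j \<omega>}"
    if "0 \<le> x" "0 \<le> y" for x y
    unfolding prob_t_gt[OF ij] using mhr D_nonneg that by (rule mhr_tail_submult)
qed

lemma fastest_time_moments:
  assumes j: "j \<in> {1..m}"
  shows "integrable M (fastest_time j)"
    and "integrable M (\<lambda>\<omega>. (fastest_time j \<omega>)\<^sup>2)"
    and "expectation (\<lambda>\<omega>. (fastest_time j \<omega>)\<^sup>2) \<le> 2 * (expectation (fastest_time j))\<^sup>2"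
proof -
  have nbu: "prob {\<omega>\<in>space M. x + y < fastest_time j \<omega>}
      \<le> prob {\<omega>\<in>space M. x < fastest_time j \<omega>} * prob {\<omega>\<in>space M. y < fastest_time j \<omega>}"
    if "0 \<le> x" "0 \<le> y" for x y
    unfolding prob_fastest_time_gt[OF j] power_mult_distrib[symmetric]
    using D.cdf_bounded_prob that by (intro power_mono mhr_tail_submult mhr D_nonneg) auto
  note assms = fastest_time_measurable[OF j] AE_fastest_time_nonneg[OF j] nbu
  show "integrable M (fastest_time j)" by (rule NBU_integrable[OF assms])
  show "integrable M (\<lambda>\<omega>. (fastest_time j \<omega>)\<^sup>2)"
    "expectation (\<lambda>\<omega>. (fastest_time j \<omega>)\<^sup>2) \<le> 2 * (expectation (fastest_time j))\<^sup>2"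
    by (rule NBU_second_moment[OF assms]; assumption)+
qed

lemma VCG_time_integrable:
  assumes ij: "i \<in> {1..n}" "j \<in> {1..m}"
  shows "integrable M (VCG_time i j)" and "integrable M (\<lambda>\<omega>. (VCG_time i j \<omega>)\<^sup>2)"
proof -
  have [measurable]: "VCG_time i j \<in> borel_measurable M" using ij by simp
  show "integrable M (VCG_time i j)"
  proof (rule Bochner_Integration.integrable_bound[OF fastest_time_moments(1)[OF ij(2)]])
    show "(VCG_time i j) \<in> borel_measurable M" by measurable
  qed (auto simp: VCG_time_def)
  show "integrable M (\<lambda>\<omega>. (VCG_time i j \<omega>)\<^sup>2)"
  proof (rule Bochner_Integration.integrable_bound[OF fastest_time_moments(2)[OF ij(2)]])
    show "(\<lambda>\<omega>. (VCG_time i j \<omega>)\<^sup>2) \<in> borel_measurable M" by measurable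
  qed (auto simp: VCG_time_def)
qed

section \<open>Absence of ties\<close>

text \<open>The pair has law D x D by independence, and every section of the diagonal is a single
  point, which is null for D.\<close>

lemma AE_no_tie:
  assumes j: "j \<in> {1..m}" and ii': "i \<in> {1..n}" "i' \<in> {1..n}" "i \<noteq> i'"
  shows "AE \<omega> in M. t i j \<omega> \<noteq> t i' j \<omega>"
proof -
  have "indep_var borel ((\<lambda>v. v i) \<circ> (\<lambda>\<omega>. restrict (\<lambda>i. t i j \<omega>) {i}))
                  borel ((\<lambda>v. v i') \<circ> (\<lambda>\<omega>. restrict (\<lambda>i. t i j \<omega>) {i'}))"
    by (rule indep_var_compose[OF indep_var_restrict[OF indep_column[OF j]]]) (use ii' in auto)
  then have "indep_var borel (t i j) borel (t i' j)" by (simp add: comp_def)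
  then have dist: "distr M (borel \<Otimes>\<^sub>M borel) (\<lambda>\<omega>. (t i j \<omega>, t i' j \<omega>)) = D \<Otimes>\<^sub>M D"
    unfolding indep_var_distribution_eq using distr_t ii' j by simp
  have "{p \<in> space (borel \<Otimes>\<^sub>M borel). fst p = (snd p :: real)} \<in> sets (borel \<Otimes>\<^sub>M borel)"
    by measurable
  then have diag [measurable]: "{p. fst p = (snd p :: real)} \<in> sets (borel \<Otimes>\<^sub>M borel)"
    by (simp add: space_pair_measure)
  have "emeasure M {\<omega>\<in>space M. t i j \<omega> = t i' j \<omega>}
      = emeasure (distr M (borel \<Otimes>\<^sub>M borel) (\<lambda>\<omega>. (t i j \<omega>, t i' j \<omega>))) {p. fst p = snd p}"
    using ii' j by (subst emeasure_distr) (auto intro!: arg_cong[where f = "emeasure M"])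
  also have "\<dots> = (\<integral>\<^sup>+x. emeasure D (Pair x -` {p. fst p = snd p}) \<partial>D)"
    unfolding dist
  proof (rule D.emeasure_pair_measure_alt)
    have "sets (D \<Otimes>\<^sub>M D) = sets (borel \<Otimes>\<^sub>M borel)" by (intro sets_pair_measure_cong) auto
    then show "{p. fst p = snd p} \<in> sets (D \<Otimes>\<^sub>M D)" using diag by simp
  qed
  also have "\<dots> = (\<integral>\<^sup>+x. emeasure D {x} \<partial>D)"
    by (intro nn_integral_cong arg_cong[where f = "emeasure D"]) auto
  also have "\<dots> = 0" by (simp add: D_singleton)
  finally have "{\<omega>\<in>space M. t i j \<omega> = t i' j \<omega>} \<in> null_sets M"
    using ii' j by (auto simp: null_sets_def)
  then show ?thesis by (intro AE_I'[of "{\<omega>\<in>space M. t i j \<omega> = t i' j \<omega>}"]) auto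
qed

lemma AE_inj_on: "AE \<omega> in M. \<forall>j\<in>{1..m}. inj_on (\<lambda>i. t i j \<omega>) {1..n}"
proof -
  have "AE \<omega> in M. \<forall>j\<in>{1..m}. \<forall>i\<in>{1..n}. \<forall>i'\<in>{1..n}. i \<noteq> i' \<longrightarrow> t i j \<omega> \<noteq> t i' j \<omega>"
    by (intro AE_finite_allI finite_atLeastAtMost AE_impI AE_no_tie)
  then show ?thesis by eventually_elim (auto simp: inj_on_def)
qed

section \<open>Symmetry between machines and independence between tasks\<close>

text \<open>Two symmetries are combined: columns of different tasks have the same law, and this
  product law is invariant under exchanging coordinates i and i', which leaves the minimum unchanged
  and carries the share of one machine to the other.\<close>

lemma expectation_VCG_time_eq:
  assumes ij: "i \<in> {1..n}" "j \<in> {1..m}" and ij': "i' \<in> {1..n}" "j' \<in> {1..m}"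
  shows "expectation (VCG_time i j) = expectation (VCG_time i' j')"
proof -
  define g :: "nat \<Rightarrow> (nat \<Rightarrow> real) \<Rightarrow> real"
    where "g i v = (if v i = (MIN k\<in>{1..n}. v k) then v i else 0)" for i v
  have g: "g i \<in> borel_measurable (PiM {1..n} (\<lambda>_. D))" if "i \<in> {1..n}" for i
  proof -
    have component: "(\<lambda>v. v k :: real) \<in> borel_measurable (PiM {1..n} (\<lambda>_. D))" if "k \<in> {1..n}" for k
      using measurable_component_singleton[OF that, of "\<lambda>_. D"]
      unfolding measurable_cong_sets[OF refl D.events_eq_borel] .
    have Min: "(\<lambda>v. MIN k\<in>{1..n}. v k :: real) \<in> borel_measurable (PiM {1..n} (\<lambda>_. D))"
      by (rule borel_measurable_Min[OF finite_atLeastAtMost component])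
    show ?thesis unfolding g_def[abs_def]
      by (intro measurable_If borel_measurable_eq component Min borel_measurable_const) fact+
  qed
  have E: "expectation (VCG_time i j) = (\<integral>v. g i v \<partial>PiM {1..n} (\<lambda>_. D))"
    if ij: "i \<in> {1..n}" "j \<in> {1..m}" for i j
  proof -
    have "(\<integral>v. g i v \<partial>PiM {1..n} (\<lambda>_. D)) = expectation (\<lambda>\<omega>. g i (\<lambda>i\<in>{1..n}. t i j \<omega>))"
      unfolding distr_column[OF ij(2), symmetric]
      by (rule integral_distr)
         (use ij g[OF ij(1)] in \<open>auto simp flip: distr_column[OF ij(2)] intro!: measurable_restrict\<close>)
    also have "\<dots> = expectation (VCG_time i j)"
      using ij by (intro arg_cong[where f = "lebesgue_integral M"] ext)
        (simp add: g_def VCG_time_def fastest_time_def)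
    finally show ?thesis ..
  qed
  define f where "f = Transposition.transpose i i'"
  have f: "f ` {1..n} = {1..n}" "inj_on f {1..n}"
    using ij ij' by (auto simp: f_def)
  have perm: "distr (PiM {1..n} (\<lambda>_. D)) (PiM {1..n} (\<lambda>_. D)) (\<lambda>v. \<lambda>k\<in>{1..n}. v (f k)) = PiM {1..n} (\<lambda>_. D)"
    using distr_PiM_reindex[of "{1..n}" "\<lambda>_. D" f "{1..n}"] f D.prob_space_axioms by blast
  have "(\<integral>v. g i v \<partial>PiM {1..n} (\<lambda>_. D))
      = (\<integral>v. g i (\<lambda>k\<in>{1..n}. v (f k)) \<partial>PiM {1..n} (\<lambda>_. D))"
  proof (subst perm[symmetric], rule integral_distr)
    show "(\<lambda>v. \<lambda>k\<in>{1..n}. v (f k)) \<in> PiM {1..n} (\<lambda>_. D) \<rightarrow>\<^sub>M PiM {1..n} (\<lambda>_. D)"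
      using f by (intro measurable_restrict measurable_component_singleton) blast
    show "g i \<in> borel_measurable (PiM {1..n} (\<lambda>_. D))"
      using ij(1) by (rule g)
  qed
  also have "\<dots> = (\<integral>v. g i' v \<partial>PiM {1..n} (\<lambda>_. D))"
  proof (intro arg_cong[where f = "lebesgue_integral _"] ext)
    fix v :: "nat \<Rightarrow> real"
    have "(\<lambda>k. (\<lambda>k\<in>{1..n}. v (f k)) k) ` {1..n} = v ` f ` {1..n}" by (auto simp: image_image)
    then have "(MIN k\<in>{1..n}. (\<lambda>k\<in>{1..n}. v (f k)) k) = (MIN k\<in>{1..n}. v k)"
      using f by simp
    then show "g i (\<lambda>k\<in>{1..n}. v (f k)) = g i' v"
      using ij by (simp add: g_def f_def)
  qed
  finally show ?thesis using E ij ij' by simp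
qed

text \<open>For a fixed machine the share of task j is a function of the times in column j, and
  distinct columns are disjoint blocks of the independent family.\<close>

lemma indep_VCG_time:
  assumes i: "i \<in> {1..n}"
  shows "indep_vars (\<lambda>_. borel) (VCG_time i) {1..m}"
proof -
  define g :: "nat \<Rightarrow> (nat \<times> nat \<Rightarrow> real) \<Rightarrow> real"
    where "g j v = (if v (i, j) = (MIN k\<in>{1..n}. v (k, j)) then v (i, j) else 0)" for j v
  have "indep_vars (\<lambda>j. PiM ({1..n} \<times> {j}) (\<lambda>_. borel))
          (\<lambda>j \<omega>. restrict (\<lambda>p. (case p of (i, j) \<Rightarrow> t i j) \<omega>) ({1..n} \<times> {j})) {1..m}"
    by (rule indep_vars_restrict[OF indep]) (auto simp: disjoint_family_on_def)
  then have "indep_vars (\<lambda>_. borel)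
      (\<lambda>j \<omega>. g j (restrict (\<lambda>p. (case p of (i, j) \<Rightarrow> t i j) \<omega>) ({1..n} \<times> {j}))) {1..m}"
  proof (rule indep_vars_compose2)
    fix j assume "j \<in> {1..m}"
    have component: "(\<lambda>v. v (k, j) :: real) \<in> borel_measurable (PiM ({1..n} \<times> {j}) (\<lambda>_. borel))"
      if "k \<in> {1..n}" for k
      using that by (intro measurable_component_singleton) auto
    have Min: "(\<lambda>v. MIN k\<in>{1..n}. v (k, j) :: real) \<in> borel_measurable (PiM ({1..n} \<times> {j}) (\<lambda>_. borel))"
      by (rule borel_measurable_Min[OF finite_atLeastAtMost component])
    show "g j \<in> borel_measurable (PiM ({1..n} \<times> {j}) (\<lambda>_. borel))"
      unfolding g_def[abs_def]
      by (intro measurable_If borel_measurable_eq component Min borel_measurable_const) fact+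
  qed
  then show ?thesis
    by (rule indep_vars_cong[THEN iffD1, rotated -1])
       (use i in \<open>auto simp: g_def VCG_time_def fastest_time_def\<close>)
qed

section \<open>Integrability of \<open>OPT\<close> and \<open>VCG\<close>\<close>

lemma makespan_integrable:
  assumes a: "\<And>j. j \<in> {1..m} \<Longrightarrow> a j \<in> {1..n}"
  shows "integrable M (\<lambda>\<omega>. makespan n m (\<lambda>i j. t i j \<omega>) a)"
  unfolding makespan_def using n
  by (intro integrable_MAX Bochner_Integration.integrable_sum integrable_t) auto

lemma OPT_integrable: "integrable M (\<lambda>\<omega>. OPT n m (\<lambda>i j. t i j \<omega>))"
  unfolding OPT_def using n
  by (intro integrable_MIN makespan_integrable) (auto simp: finite_PiE PiE_eq_empty_iff)

text \<open>Since \<open>M\<close> need not be complete, almost sure equality with a measurable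
  function would not give this; hence the exact formula.\<close>

lemma VCG_measurable: "(\<lambda>\<omega>. VCG n m (\<lambda>i j. t i j \<omega>)) \<in> borel_measurable M"
  unfolding VCG_eq_sum[OF n] fastest_time_def[symmetric]
proof (intro borel_measurable_sum borel_measurable_times borel_measurable_prod borel_measurable_divide)
  fix a assume a: "a \<in> PiE_dflt {1..m} undefined (\<lambda>_. {1..n})"
  then show "(\<lambda>\<omega>. makespan n m (\<lambda>i j. t i j \<omega>) a) \<in> borel_measurable M"
    by (intro borel_measurable_integrable makespan_integrable) (auto simp: PiE_dflt_def)
  fix j assume j: "j \<in> {1..m}"
  then show "(\<lambda>\<omega>. if t (a j) j \<omega> = fastest_time j \<omega> then 1 else 0 :: real) \<in> borel_measurable M"
    using a by (intro measurable_If borel_measurable_eq t_measurable fastest_time_measurable)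
      (auto simp: PiE_dflt_def)
next
  fix j i assume "j \<in> {1..m}" "i \<in> {1..n}"
  then show "(\<lambda>\<omega>. if t i j \<omega> = fastest_time j \<omega> then 1 else 0 :: real) \<in> borel_measurable M"
    by (intro measurable_If borel_measurable_eq t_measurable fastest_time_measurable) auto
qed

definition VCG_load :: "nat \<Rightarrow> 'a \<Rightarrow> real" where
  "VCG_load i \<omega> = (\<Sum>j\<in>{1..m}. VCG_time i j \<omega>)"

lemma VCG_load_integrable:
  assumes "i \<in> {1..n}"
  shows "integrable M (VCG_load i)"
  unfolding VCG_load_def[abs_def] using assms
  by (intro Bochner_Integration.integrable_sum VCG_time_integrable)

lemma AE_VCG_eq: "AE \<omega> in M. VCG n m (\<lambda>i j. t i j \<omega>) = (MAX i\<in>{1..n}. VCG_load i \<omega>)"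
  using AE_inj_on
proof eventually_elim
  case (elim \<omega>)
  then show ?case
    using VCG_no_ties[OF n, of m "\<lambda>i j. t i j \<omega>"]
    by (simp add: VCG_load_def VCG_time_def fastest_time_def)
qed

lemma max_VCG_load_integrable: "integrable M (\<lambda>\<omega>. MAX i\<in>{1..n}. VCG_load i \<omega>)"
  using n by (intro integrable_MAX VCG_load_integrable) auto

lemma VCG_integrable: "integrable M (\<lambda>\<omega>. VCG n m (\<lambda>i j. t i j \<omega>))"
  using max_VCG_load_integrable AE_VCG_eq VCG_measurable
  by (subst integrable_cong_AE[OF _ _ AE_VCG_eq]) auto

lemma expectation_VCG_eq:
  "expectation (\<lambda>\<omega>. VCG n m (\<lambda>i j. t i j \<omega>)) = expectation (\<lambda>\<omega>. MAX i\<in>{1..n}. VCG_load i \<omega>)"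
  using max_VCG_load_integrable VCG_measurable
  by (intro integral_cong_AE[OF _ _ AE_VCG_eq]) auto

section \<open>Means, deviations and the final estimate\<close>

text \<open>By symmetry machine 1 and task 1 stand for any pair. In the notation of the overview
  this is mu / n, so that \<open>real m * mean_VCG_time\<close> is c.\<close>

definition mean_VCG_time :: real where
  "mean_VCG_time = expectation (VCG_time 1 1)"

lemma expectation_VCG_time:
  assumes "i \<in> {1..n}" "j \<in> {1..m}"
  shows "expectation (VCG_time i j) = mean_VCG_time"
  unfolding mean_VCG_time_def using assms n by (intro expectation_VCG_time_eq) auto

text \<open>The n shares of a task add up almost surely to its fastest time, and they have equal
  means.\<close>

lemma expectation_fastest_time:
  assumes j: "j \<in> {1..m}"
  shows "expectation (fastest_time j) = real n * mean_VCG_time"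
proof -
  have "AE \<omega> in M. fastest_time j \<omega> = (\<Sum>i\<in>{1..n}. VCG_time i j \<omega>)"
    using AE_inj_on
  proof eventually_elim
    case (elim \<omega>)
    then show ?case
      using sum_fastest[OF n, of "\<lambda>i j. t i j \<omega>" j "\<lambda>x. x"] j
      by (simp add: VCG_time_def fastest_time_def)
  qed
  then have "expectation (fastest_time j) = expectation (\<lambda>\<omega>. \<Sum>i\<in>{1..n}. VCG_time i j \<omega>)"
    using j by (intro integral_cong_AE) auto
  also have "\<dots> = (\<Sum>i\<in>{1..n}. expectation (VCG_time i j))"
    using j by (intro Bochner_Integration.integral_sum VCG_time_integrable)
  also have "\<dots> = real n * mean_VCG_time"
    using j expectation_VCG_time by simp
  finally show ?thesis .
qed

text \<open>Squares of shares add up too: almost surely at most one share is nonzero, so there are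
  no mixed terms.\<close>

lemma expectation_fastest_time_square:
  assumes j: "j \<in> {1..m}"
  shows "expectation (\<lambda>\<omega>. (fastest_time j \<omega>)\<^sup>2) = (\<Sum>i\<in>{1..n}. expectation (\<lambda>\<omega>. (VCG_time i j \<omega>)\<^sup>2))"
proof -
  have "AE \<omega> in M. (fastest_time j \<omega>)\<^sup>2 = (\<Sum>i\<in>{1..n}. (VCG_time i j \<omega>)\<^sup>2)"
    using AE_inj_on
  proof eventually_elim
    case (elim \<omega>)
    have "(VCG_time i j \<omega>)\<^sup>2 = (if t i j \<omega> = fastest_time j \<omega> then (t i j \<omega>)\<^sup>2 else 0)" for i
      by (simp add: VCG_time_def)
    then show ?case
      using sum_fastest[OF n, of "\<lambda>i j. t i j \<omega>" j "\<lambda>x. x\<^sup>2"] j elim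
      by (simp add: fastest_time_def)
  qed
  then have "expectation (\<lambda>\<omega>. (fastest_time j \<omega>)\<^sup>2) = expectation (\<lambda>\<omega>. \<Sum>i\<in>{1..n}. (VCG_time i j \<omega>)\<^sup>2)"
    using j by (intro integral_cong_AE) auto
  also have "\<dots> = (\<Sum>i\<in>{1..n}. expectation (\<lambda>\<omega>. (VCG_time i j \<omega>)\<^sup>2))"
    using j by (intro Bochner_Integration.integral_sum VCG_time_integrable)
  finally show ?thesis .
qed

text \<open>Independence between tasks makes the variances add; each is then bounded by the second
  moment because only second moments sum over the machines to that of the fastest time.\<close>

lemma VCG_load_deviation:
  assumes i: "i \<in> {1..n}"
  shows "integrable M (\<lambda>\<omega>. (VCG_load i \<omega> - real m * mean_VCG_time)\<^sup>2)"
    and "expectation (\<lambda>\<omega>. (VCG_load i \<omega> - real m * mean_VCG_time)\<^sup>2)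
           \<le> (\<Sum>j\<in>{1..m}. expectation (\<lambda>\<omega>. (VCG_time i j \<omega>)\<^sup>2))"
proof -
  note var = variance_sum_indep[OF indep_VCG_time[OF i] finite_atLeastAtMost
      VCG_time_integrable(1)[OF i] VCG_time_integrable(2)[OF i]]
  have mean: "(\<Sum>j\<in>{1..m}. expectation (VCG_time i j)) = real m * mean_VCG_time"
    using expectation_VCG_time[OF i] by simp
  show "integrable M (\<lambda>\<omega>. (VCG_load i \<omega> - real m * mean_VCG_time)\<^sup>2)"
    using var(1) unfolding mean VCG_load_def .
  have "expectation (\<lambda>\<omega>. \<Sum>j\<in>{1..m}. VCG_time i j \<omega>) = real m * mean_VCG_time"
    unfolding mean[symmetric] using i by (intro Bochner_Integration.integral_sum VCG_time_integrable)
  then have "expectation (\<lambda>\<omega>. (VCG_load i \<omega> - real m * mean_VCG_time)\<^sup>2)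
      = (\<Sum>j\<in>{1..m}. variance (VCG_time i j))"
    using var(2) by (simp add: VCG_load_def)
  also have "\<dots> \<le> (\<Sum>j\<in>{1..m}. expectation (\<lambda>\<omega>. (VCG_time i j \<omega>)\<^sup>2))"
    using i VCG_time_integrable by (intro sum_mono) (simp add: variance_eq)
  finally show "expectation (\<lambda>\<omega>. (VCG_load i \<omega> - real m * mean_VCG_time)\<^sup>2)
      \<le> (\<Sum>j\<in>{1..m}. expectation (\<lambda>\<omega>. (VCG_time i j \<omega>)\<^sup>2))" .
qed

lemma mean_le_expectation_OPT:
  "real m * mean_VCG_time \<le> expectation (\<lambda>\<omega>. OPT n m (\<lambda>i j. t i j \<omega>))"
proof -
  have "real n * (real m * mean_VCG_time) = (\<Sum>j\<in>{1..m}. expectation (fastest_time j))"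
    using expectation_fastest_time by simp
  also have "\<dots> = expectation (\<lambda>\<omega>. \<Sum>j\<in>{1..m}. fastest_time j \<omega>)"
    by (intro Bochner_Integration.integral_sum[symmetric] fastest_time_moments)
  also have "\<dots> \<le> expectation (\<lambda>\<omega>. real n * OPT n m (\<lambda>i j. t i j \<omega>))"
    unfolding fastest_time_def
    by (intro integral_mono sum_Min_le_OPT n Bochner_Integration.integrable_sum
          fastest_time_moments(1)[unfolded fastest_time_def[abs_def]]
          integrable_mult_right OPT_integrable)
  also have "\<dots> = real n * expectation (\<lambda>\<omega>. OPT n m (\<lambda>i j. t i j \<omega>))" by simp
  finally show ?thesis using n by simp
qed

lemma expectation_VCG_le:
  assumes "n\<^sup>2 \<le> m"
  shows "expectation (\<lambda>\<omega>. VCG n m (\<lambda>i j. t i j \<omega>)) \<le> (1 + sqrt 2) * (real m * mean_VCG_time)"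
proof -
  \<comment> \<open>Task 1 therefore exists, and the sign of \<open>mean_VCG_time\<close> follows
    from that of its fastest time; the sign is needed to take the square root at the end.\<close>
  have "1 \<le> m" using n assms by (metis le_trans one_le_power)
  then have "0 \<le> expectation (fastest_time 1)"
    using AE_fastest_time_nonneg[of 1] by (intro integral_nonneg_AE) auto
  then have mean0: "0 \<le> mean_VCG_time"
    using \<open>1 \<le> m\<close> n by (simp add: expectation_fastest_time zero_le_mult_iff)
  have "expectation (\<lambda>\<omega>. VCG n m (\<lambda>i j. t i j \<omega>))
      \<le> real m * mean_VCG_time
         + sqrt (\<Sum>i\<in>{1..n}. expectation (\<lambda>\<omega>. (VCG_load i \<omega> - real m * mean_VCG_time)\<^sup>2))"
    unfolding expectation_VCG_eq using n
    by (intro expectation_Max_le VCG_load_integrable VCG_load_deviation) auto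
  \<comment> \<open>From here on the chain bounds the expression under the square root.\<close>
  also have "(\<Sum>i\<in>{1..n}. expectation (\<lambda>\<omega>. (VCG_load i \<omega> - real m * mean_VCG_time)\<^sup>2))
      \<le> (\<Sum>i\<in>{1..n}. \<Sum>j\<in>{1..m}. expectation (\<lambda>\<omega>. (VCG_time i j \<omega>)\<^sup>2))"
    by (intro sum_mono VCG_load_deviation)
  also have "\<dots> = (\<Sum>j\<in>{1..m}. expectation (\<lambda>\<omega>. (fastest_time j \<omega>)\<^sup>2))"
    by (subst sum.swap) (simp add: expectation_fastest_time_square)
  also have "\<dots> \<le> (\<Sum>j\<in>{1..m}. 2 * (real n * mean_VCG_time)\<^sup>2)"
    using fastest_time_moments(3) by (intro sum_mono) (simp add: expectation_fastest_time)
  also have "\<dots> = 2 * real m * real (n\<^sup>2) * mean_VCG_time\<^sup>2"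
    by (simp add: power_mult_distrib)
  \<comment> \<open>Replacing n^2 by m completes the square: the expression becomes 2 c^2, whose
    root is sqrt 2 times the mean load c.\<close>
  also have "\<dots> \<le> 2 * real m * real m * mean_VCG_time\<^sup>2"
    using assms by (intro mult_mono) auto
  also have "\<dots> = 2 * (real m * mean_VCG_time)\<^sup>2"
    by (simp add: power2_eq_square)
  also have "sqrt \<dots> = sqrt 2 * (real m * mean_VCG_time)"
    using mean0 by (simp add: real_sqrt_mult)
  finally show ?thesis by (simp add: algebra_simps)
qed

end

theorem theorem9:
  fixes n m :: nat
    and D :: "real measure"
    and M :: "'a measure"
    and t :: "nat \<Rightarrow> nat \<Rightarrow> 'a \<Rightarrow> real"
  assumes "n \<ge> 1" and "m \<ge> n\<^sup>2"
    and "mhr_distribution D" and "AE x in D. 0 \<le> x"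
    and "prob_space M"
    and "prob_space.indep_vars M (\<lambda>_. borel) (\<lambda>(i, j). t i j) ({1..n} \<times> {1..m})"
    and "\<And>i j. i \<in> {1..n} \<Longrightarrow> j \<in> {1..m} \<Longrightarrow> distr M borel (t i j) = D"
  shows "integrable M (\<lambda>\<omega>. VCG n m (\<lambda>i j. t i j \<omega>)) \<and>
         integrable M (\<lambda>\<omega>. OPT n m (\<lambda>i j. t i j \<omega>)) \<and>
         prob_space.expectation M (\<lambda>\<omega>. VCG n m (\<lambda>i j. t i j \<omega>))
           \<le> (1 + sqrt 2) * prob_space.expectation M (\<lambda>\<omega>. OPT n m (\<lambda>i j. t i j \<omega>))"
proof -
  interpret iid_mhr_times M n m D t
    using assms by (intro iid_mhr_times.intro iid_mhr_times_axioms.intro)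
  have "expectation (\<lambda>\<omega>. VCG n m (\<lambda>i j. t i j \<omega>)) \<le> (1 + sqrt 2) * (real m * mean_VCG_time)"
    using \<open>m \<ge> n\<^sup>2\<close> by (rule expectation_VCG_le)
  also have "\<dots> \<le> (1 + sqrt 2) * expectation (\<lambda>\<omega>. OPT n m (\<lambda>i j. t i j \<omega>))"
    by (intro mult_left_mono mean_le_expectation_OPT) auto
  finally show ?thesis using VCG_integrable OPT_integrable by blast
qed

end
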